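(* Let $\langle X,\mathcal{K},T\rangle$ be a MoS-space. Then the following hold: 1. $T=T_{R_T}$; 2. $m_{R_T}=\Box_T$ (as maps on $S(X)$).
   Context: **S-spaces.** Let $X$ be a set and $\mathcal{K}\subseteq\mathcal{P}(X)$, regarded as a subbase of a topology on $X$. Put $S(X)=\{U^c: U\in\mathcal{K}\}$ and $\mathcal{C}_{\mathcal{K}}(X)=\{\bigcap\mathcal{A}:\mathcal{A}\subseteq S(X)\}$ (with $\bigcap\emptyset=X$). For $Y\subseteq X$, a family $\mathcal{J}\subseteq S(X)$ is a $Y$-family if for all $A,B\in\mathcal{J}$ there are $H\in S(X)$, $C\in\mathcal{J}$ with $Y\subseteq H$, $A\cap H\subseteq C$ and $B\cap H\subseteq C$. $\langle X,\mathcal{K}\rangle$ is an S-space if: (S1) the topology is $T_0$ and $X=\bigcup\mathcal{K}$; (S2) $\mathcal{K}$ is a subbase of compact open sets, closed under finite unions, and $\emptyset\in\mathcal{K}$; (S3) if $x\in U\cap V$ with $U,V\in\mathcal{K}$, there are $W,D\in\mathcal{K}$ with $x\notin W$, $x\in D$, $D\subseteq(U\cap V)\cup W$; (S4) if $Y\in\mathcal{C}_{\mathcal{K}}(X)$ and $\mathcal{J}\subseteq S(X)$ is a $Y$-family with $Y\cap A^c\neq\emptyset$ for all $A\in\mathcal{J}$, then $Y\cap\bigcap\{A^c:A\in\mathcal{J}\}\neq\emptyset$. Then $\mathbf{S}(X)=\langle S(X),\cap,X\rangle$ is a meet-semilattice with greatest element. For $T\subseteq X\times X$ write $T(x)=\{y:(x,y)\in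 T\}$, $\Box_T(U)=\{x:T(x)\subseteq U\}$. $T$ is a meet-relation if $\Box_T(U)\in S(X)$ for all $U\in S(X)$ and $T(x)=\bigcap\{U\in S(X):T(x)\subseteq U\}$ for all $x$. A MoS-space is $\langle X,\mathcal{K},T\rangle$ with $\langle X,\mathcal{K}\rangle$ an S-space and $T\subseteq X\times X$ a meet-relation. $\mathcal{Z}(X)$ is the set of all $Z=\bigcap\mathcal{L}$ with $\mathcal{L}\subseteq\mathcal{K}$ non-empty and dually directed under $\subseteq$. For $U\in S(X)$, $L_U=\{Z\in\mathcal{Z}(X):Z\cap U\neq\emptyset\}$; for $R\subseteq X\times\mathcal{Z}(X)$ and $U\in S(X)$, $m_R(U)=\{x\in X:R(x)\subseteq L_U\}$. For a semilattice $\mathbf{A}$, $\mathcal{X}(\mathbf{A})$ is the set of irreducible filters (proper filters $F$ such that $F=F_1\cap F_2$ with $F_1,F_2$ filters implies $F=F_1$ or $F=F_2$), $\beta_{\mathbf{A}}(a)=\{P\in\mathcal{X}(\mathbf{A}):a\in P\}$, and $\mathcal{K}_{\mathbf{A}}=\{\beta_{\mathbf{A}}(a)^c:a\in A\}$; $\langle\mathcal{X}(\mathbf{A}),\mathcal{K}_{\mathbf{A}}\rangle$ is an S-space. For a monotone $m:A\to A$, $R_m\subseteq\mathcal{X}(\mathbf{A})\times\mathcal{Z}(\mathcal{X}(\mathbf{A}))$ is given by $(P,Z)\in R_m\iff m^{-1}[P]\cap I_{\mathbf{A}}(Z)=\emptyset$, where $I_{\mathbf{A}}(Z)=\{a\in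 A:\beta_{\mathbf{A}}(a)\cap Z=\emptyset\}$. For $m:A\to A$, $N_m\subseteq\mathcal{X}(\mathbf{A})\times\mathcal{X}(\mathbf{A})$ is given by $(P,Q)\in N_m\iff m^{-1}[P]\subseteq Q$. For an S-space, $H_X:X\to\mathcal{X}(\mathbf{S}(X))$, $H_X(x)=\{A\in S(X):x\in A\}$, is a homeomorphism. For a meet-relation $T$ on $X$, the multirelation $R_T\subseteq X\times\mathcal{Z}(X)$ is defined by $(x,Z)\in R_T\iff(H_X(x),H_X[Z])\in R_{\Box_T}$. For a multirelation $R\subseteq X\times\mathcal{Z}(X)$ with $m_R(U)\in S(X)$ for all $U\in S(X)$, the relation $T_R\subseteq X\times X$ is defined by $(x,y)\in T_R\iff(H_X(x),H_X(y))\in N_{m_R}$. *)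

theory Defs
  imports "HOL-Analysis.Analysis"
begin

record 'a semilat =
  sl_carrier :: "'a set"
  sl_meet :: "'a \<Rightarrow> 'a \<Rightarrow> 'a"
  sl_top :: 'a

definition sl_le :: "'a semilat \<Rightarrow> 'a \<Rightarrow> 'a \<Rightarrow> bool" where
  "sl_le A a b \<longleftrightarrow> sl_meet A a b = a"

locale meet_semilat =
  fixes A :: "'a semilat"
  assumes meet_closed:
      "a \<in> sl_carrier A \<Longrightarrow> b \<in> sl_carrier A \<Longrightarrow> sl_meet A a b \<in> sl_carrier A"
    and top_closed: "sl_top A \<in> sl_carrier A"
    and meet_assoc: "a \<in> sl_carrier A \<Longrightarrow> b \<in> sl_carrier A \<Longrightarrow> c \<in> sl_carrier A \<Longrightarrow>
      sl_meet A (sl_meet A a b) c = sl_meet A a (sl_meet A b c)"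
    and meet_commute:
      "a \<in> sl_carrier A \<Longrightarrow> b \<in> sl_carrier A \<Longrightarrow> sl_meet A a b = sl_meet A b a"
    and meet_idem: "a \<in> sl_carrier A \<Longrightarrow> sl_meet A a a = a"
    and meet_top: "a \<in> sl_carrier A \<Longrightarrow> sl_meet A a (sl_top A) = a"

definition sl_filter :: "'a semilat \<Rightarrow> 'a set \<Rightarrow> bool" where
  "sl_filter A F \<longleftrightarrow>
     F \<subseteq> sl_carrier A \<and> sl_top A \<in> F \<and>
     (\<forall>a\<in>F. \<forall>b\<in>sl_carrier A. sl_le A a b \<longrightarrow> b \<in> F) \<and>
     (\<forall>a\<in>F. \<forall>b\<in>F. sl_meet A a b \<in> F)"

definition irr_filters :: "'a semilat \<Rightarrow> 'a set set" where
  "irr_filters A = {F. sl_filter A F \<and> F \<noteq> sl_carrier A \<and>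
     (\<forall>F1 F2. sl_filter A F1 \<and> sl_filter A F2 \<and> F = F1 \<inter> F2 \<longrightarrow> F = F1 \<or> F = F2)}"

definition beta :: "'a semilat \<Rightarrow> 'a \<Rightarrow> 'a set set" where
  "beta A a = {P \<in> irr_filters A. a \<in> P}"

definition KA :: "'a semilat \<Rightarrow> 'a set set set" where
  "KA A = {irr_filters A - beta A a | a. a \<in> sl_carrier A}"

definition Sfam :: "'a set \<Rightarrow> 'a set set \<Rightarrow> 'a set set" where
  "Sfam X K = {X - U | U. U \<in> K}"

text \<open>The intersection with \<open>X\<close> makes the intersection of the empty family equal to \<open>X\<close>
  (rather than to the whole type).\<close>

definition Cfam :: "'a set \<Rightarrow> 'a set set \<Rightarrow> 'a set set" where
  "Cfam X K = {X \<inter> \<Inter>\<A> | \<A>. \<A> \<subseteq> Sfam X K}"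

text \<open>As usual for directed families, a \<open>Y\<close>-family is non-empty. Without this convention, condition
  (S4) below would be unsatisfiable: the empty set is the intersection of all members
  of \<open>Sfam X K\<close> when \<open>X = \<Union>K\<close>, and (S4) for \<open>Y = J = {}\<close> would then assert
  \<open>{} \<noteq> {}\<close>.\<close>

definition Y_family :: "'a set \<Rightarrow> 'a set set \<Rightarrow> 'a set \<Rightarrow> 'a set set \<Rightarrow> bool" where
  "Y_family X K Y J \<longleftrightarrow> J \<subseteq> Sfam X K \<and> J \<noteq> {} \<and>
     (\<forall>A\<in>J. \<forall>B\<in>J. \<exists>H\<in>Sfam X K. \<exists>C\<in>J. Y \<subseteq> H \<and> A \<inter> H \<subseteq> C \<and> B \<inter> H \<subseteq> C)"

text \<open>The topology with subbase \<open>K\<close> is \<open>topology_generated_by K\<close>; its underlying set is \<open>\<Union>K\<close>,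
  which is \<open>X\<close> by (S1).\<close>

locale S_space =
  fixes X :: "'a set" and K :: "'a set set"
  assumes S1_t0: "t0_space (topology_generated_by K)"
    and S1_cover: "X = \<Union>K"
    and S2_compact: "\<forall>U\<in>K. compactin (topology_generated_by K) U"
    and S2_union: "\<forall>U\<in>K. \<forall>V\<in>K. U \<union> V \<in> K"
    and S2_empty: "{} \<in> K"
    and S3: "\<forall>U\<in>K. \<forall>V\<in>K. \<forall>x\<in>U \<inter> V. \<exists>W\<in>K. \<exists>D\<in>K. x \<notin> W \<and> x \<in> D \<and> D \<subseteq> (U \<inter> V) \<union> W"
    and S4: "\<forall>Y\<in>Cfam X K. \<forall>J. Y_family X K Y J \<and> (\<forall>A\<in>J. Y \<inter> (X - A) \<noteq> {}) \<longrightarrow>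
               Y \<inter> (\<Inter>A\<in>J. X - A) \<noteq> {}"

definition S_semilat :: "'a set \<Rightarrow> 'a set set \<Rightarrow> 'a set semilat" where
  "S_semilat X K = \<lparr>sl_carrier = Sfam X K, sl_meet = (\<inter>), sl_top = X\<rparr>"

lemma (in S_space) meet_semilat_S_semilat: "meet_semilat (S_semilat X K)"
proof
  fix a b
  assume "a \<in> sl_carrier (S_semilat X K)" "b \<in> sl_carrier (S_semilat X K)"
  then obtain U V where "a = X - U" "b = X - V" "U \<in> K" "V \<in> K"
    by (auto simp: S_semilat_def Sfam_def)
  moreover from this have "a \<inter> b = X - (U \<union> V)" "U \<union> V \<in> K"
    using S2_union by auto
  ultimately show "sl_meet (S_semilat X K) a b \<in> sl_carrier (S_semilat X K)"
    by (auto simp: S_semilat_def Sfam_def)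
next
  show "sl_top (S_semilat X K) \<in> sl_carrier (S_semilat X K)"
    using S2_empty by (auto simp: S_semilat_def Sfam_def)
qed (auto simp: S_semilat_def Sfam_def)

definition H_map :: "'a set \<Rightarrow> 'a set set \<Rightarrow> 'a \<Rightarrow> 'a set set" where
  "H_map X K x = {A \<in> Sfam X K. x \<in> A}"

definition Box :: "'a set \<Rightarrow> ('a \<times> 'a) set \<Rightarrow> 'a set \<Rightarrow> 'a set" where
  "Box X T U = {x \<in> X. T `` {x} \<subseteq> U}"

definition meet_relation :: "'a set \<Rightarrow> 'a set set \<Rightarrow> ('a \<times> 'a) set \<Rightarrow> bool" where
  "meet_relation X K T \<longleftrightarrow> T \<subseteq> X \<times> X \<and>
     (\<forall>U\<in>Sfam X K. Box X T U \<in> Sfam X K) \<and>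
     (\<forall>x\<in>X. T `` {x} = X \<inter> \<Inter>{U \<in> Sfam X K. T `` {x} \<subseteq> U})"

locale MoS_space = S_space X K for X :: "'a set" and K :: "'a set set" +
  fixes T :: "('a \<times> 'a) set"
  assumes meet_rel: "meet_relation X K T"

definition Zfam :: "'a set set \<Rightarrow> 'a set set" where
  "Zfam K = {\<Inter>L | L. L \<subseteq> K \<and> L \<noteq> {} \<and> (\<forall>U\<in>L. \<forall>V\<in>L. \<exists>W\<in>L. W \<subseteq> U \<and> W \<subseteq> V)}"

definition Lset :: "'a set set \<Rightarrow> 'a set \<Rightarrow> 'a set set" where
  "Lset K U = {Z \<in> Zfam K. Z \<inter> U \<noteq> {}}"

definition m_of :: "'a set \<Rightarrow> 'a set set \<Rightarrow> ('a \<times> 'a set) set \<Rightarrow> 'a set \<Rightarrow> 'a set" where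
  "m_of X K R U = {x \<in> X. R `` {x} \<subseteq> Lset K U}"

definition I_of :: "'a semilat \<Rightarrow> 'a set set \<Rightarrow> 'a set" where
  "I_of A Z = {a \<in> sl_carrier A. beta A a \<inter> Z = {}}"

definition R_of :: "'a semilat \<Rightarrow> ('a \<Rightarrow> 'a) \<Rightarrow> ('a set \<times> 'a set set) set" where
  "R_of A m = {(P, Z) \<in> irr_filters A \<times> Zfam (KA A).
     {a \<in> sl_carrier A. m a \<in> P} \<inter> I_of A Z = {}}"

definition N_of :: "'a semilat \<Rightarrow> ('a \<Rightarrow> 'a) \<Rightarrow> ('a set \<times> 'a set) set" where
  "N_of A m = {(P, Q) \<in> irr_filters A \<times> irr_filters A.
     {a \<in> sl_carrier A. m a \<in> P} \<subseteq> Q}"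

definition R_rel :: "'a set \<Rightarrow> 'a set set \<Rightarrow> ('a \<times> 'a) set \<Rightarrow> ('a \<times> 'a set) set" where
  "R_rel X K T = {(x, Z) \<in> X \<times> Zfam K.
     (H_map X K x, H_map X K ` Z) \<in> R_of (S_semilat X K) (Box X T)}"

text \<open>Meaningful when \<open>m_of X K R\<close> maps \<open>Sfam X K\<close> into itself.\<close>

definition T_rel :: "'a set \<Rightarrow> 'a set set \<Rightarrow> ('a \<times> 'a set) set \<Rightarrow> ('a \<times> 'a) set" where
  "T_rel X K R = {(x, y) \<in> X \<times> X.
     (H_map X K x, H_map X K y) \<in> N_of (S_semilat X K) (m_of X K R)}"

end

theory Submission
  imports Defs
begin

text \<open>The map \<open>H\<close> sends \<open>X\<close> onto the irreducible filters of \<open>S(X)\<close>: \<open>H(x)\<close> is irreducible by (S3), and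
  an irreducible filter \<open>P\<close> equals \<open>H(x)\<close> for any \<open>x \<in> \<Inter>P\<close> lying outside every member of \<open>S(X) - P\<close>;
  such a point exists by (S4), irreducibility making \<open>S(X) - P\<close> an \<open>\<Inter>P\<close>-family and compactness
  showing that \<open>\<Inter>P\<close> is not contained in a member of \<open>S(X) - P\<close>. Hence \<open>Z \<in> R\<^sub>T(x)\<close> means that \<open>Z\<close> meets
  every \<open>V \<in> S(X)\<close> with \<open>T(x) \<subseteq> V\<close>. If \<open>T(x)\<close> is not contained in \<open>U \<in> S(X)\<close>, then \<open>Z = X - U\<close> is in
  \<open>R\<^sub>T(x)\<close> and misses \<open>U\<close>, so \<open>m\<^bsub>R\<^sub>T\<^esub>(U) = \<box>\<^sub>T(U)\<close>. Both claims follow, the first one because \<open>T(x)\<close> is the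
  intersection of the members of \<open>S(X)\<close> that contain it.\<close>

section \<open>Filters and closure properties of the semilattice
  \<open>S_semilat X K\<close>\<close>

lemma sl_filter_S_semilat_iff:
  "sl_filter (S_semilat X K) F \<longleftrightarrow>
     F \<subseteq> Sfam X K \<and> X \<in> F \<and> (\<forall>A\<in>F. \<forall>B\<in>Sfam X K. A \<subseteq> B \<longrightarrow> B \<in> F) \<and> (\<forall>A\<in>F. \<forall>B\<in>F. A \<inter> B \<in> F)"
  by (simp add: sl_filter_def S_semilat_def sl_le_def Int_absorb2 inf.absorb_iff1)

context S_space
begin

lemma subset_X: "U \<in> K \<Longrightarrow> U \<subseteq> X"
  using S1_cover by blast

lemma Sfam_subset_X: "A \<in> Sfam X K \<Longrightarrow> A \<subseteq> X"
  by (auto simp: Sfam_def)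

lemma compl_in_Sfam: "U \<in> K \<Longrightarrow> X - U \<in> Sfam X K"
  by (auto simp: Sfam_def)

lemma compl_in_K: "A \<in> Sfam X K \<Longrightarrow> X - A \<in> K"
  using subset_X by (auto simp: Sfam_def double_diff)

lemma Sfam_Int: "A \<in> Sfam X K \<Longrightarrow> B \<in> Sfam X K \<Longrightarrow> A \<inter> B \<in> Sfam X K"
  using S2_union by (auto simp: Sfam_def Diff_Un[symmetric])

lemma X_in_Sfam: "X \<in> Sfam X K"
  using S2_empty compl_in_Sfam by fastforce

section \<open>Points of \<open>X\<close> and irreducible filters\<close>

lemma H_map_irr:
  assumes x: "x \<in> X"
  shows "H_map X K x \<in> irr_filters (S_semilat X K)"
proof -
  have fil: "sl_filter (S_semilat X K) (H_map X K x)"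
    using x X_in_Sfam Sfam_Int by (auto simp: sl_filter_S_semilat_iff H_map_def)
  obtain U where "U \<in> K" "x \<in> U"
    using x S1_cover by blast
  then have "X - U \<in> Sfam X K" "X - U \<notin> H_map X K x"
    by (auto simp: Sfam_def H_map_def)
  then have proper: "H_map X K x \<noteq> sl_carrier (S_semilat X K)"
    by (auto simp: S_semilat_def)
  have "H_map X K x = F1 \<or> H_map X K x = F2"
    if F1: "sl_filter (S_semilat X K) F1" and F2: "sl_filter (S_semilat X K) F2"
      and eq: "H_map X K x = F1 \<inter> F2" for F1 F2
  proof (rule ccontr)
    assume "\<not> ?thesis"
    then obtain A B where A: "A \<in> F1" "A \<notin> H_map X K x" and B: "B \<in> F2" "B \<notin> H_map X K x"
      using eq by blast
    have AS: "A \<in> Sfam X K" and BS: "B \<in> Sfam X K"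
      using A B F1 F2 by (auto simp: sl_filter_S_semilat_iff)
    \<comment> \<open>The point \<open>x\<close> lies outside both \<open>A\<close> and
      \<open>B\<close>, so (S3) applies to their complements.\<close>
    then have "X - A \<in> K" "X - B \<in> K" "x \<in> (X - A) \<inter> (X - B)"
      using A B x compl_in_K by (auto simp: H_map_def)
    then obtain W D where W: "W \<in> K" "x \<notin> W" and D: "D \<in> K" "x \<in> D"
      and sub: "D \<subseteq> ((X - A) \<inter> (X - B)) \<union> W"
      using S3 by meson
    \<comment> \<open>Below \<open>X - W\<close>, which lies in both filters, (S3) puts
      \<open>A\<close> and \<open>B\<close> under \<open>X - D\<close>. Hence \<open>X - D\<close>
      lies in \<open>F1 \<inter> F2\<close>, although \<open>x \<in> D\<close>.\<close>
    have "X - W \<in> F1 \<inter> F2"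
      using W x compl_in_Sfam unfolding eq[symmetric] by (auto simp: H_map_def)
    then have "A \<inter> (X - W) \<in> F1" "B \<inter> (X - W) \<in> F2"
      using A B F1 F2 by (auto simp: sl_filter_S_semilat_iff)
    moreover have "A \<inter> (X - W) \<subseteq> X - D" "B \<inter> (X - W) \<subseteq> X - D"
      using sub by auto
    ultimately have "X - D \<in> F1 \<inter> F2"
      using F1 F2 compl_in_Sfam[OF D(1)] unfolding sl_filter_S_semilat_iff by blast
    then show False
      using D unfolding eq[symmetric] by (simp add: H_map_def)
  qed
  with fil proper show ?thesis
    unfolding irr_filters_def by blast
qed

text \<open>The factor \<open>X\<close> turns the empty intersection into the top element; an empty
  subcover can occur below when \<open>A = X\<close>.\<close>

lemma filter_finite_Inter:
  assumes "sl_filter (S_semilat X K) P" "finite \<F>" "\<F> \<subseteq> P"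
  shows "X \<inter> \<Inter>\<F> \<in> P"
  using assms(2,3)
proof (induction \<F> rule: finite_induct)
  case empty
  then show ?case
    using assms(1) by (simp add: sl_filter_S_semilat_iff)
next
  case (insert A \<F>)
  then have "A \<inter> (X \<inter> \<Inter>\<F>) \<in> P"
    using assms(1) by (simp add: sl_filter_S_semilat_iff)
  then show ?case
    by (simp add: Int_left_commute)
qed

text \<open>The complements of the members of \<open>P\<close> form an open cover of the compact set
  \<open>X - A\<close>. A finite subcover gives a finite meet of members of \<open>P\<close> below
  \<open>A\<close>.\<close>

lemma filter_Inter_subset_imp_mem:
  assumes P: "sl_filter (S_semilat X K) P" and A: "A \<in> Sfam X K" and sub: "X \<inter> \<Inter>P \<subseteq> A"
  shows "A \<in> P"
proof -
  have PS: "P \<subseteq> Sfam X K"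
    using P by (simp add: sl_filter_S_semilat_iff)
  let ?U = "(\<lambda>B. X - B) ` P"
  have "compactin (topology_generated_by K) (X - A)"
    using A compl_in_K S2_compact by blast
  moreover have "\<And>U. U \<in> ?U \<Longrightarrow> openin (topology_generated_by K) U"
    using PS compl_in_K by (auto intro: topology_generated_by_Basis)
  moreover have "X - A \<subseteq> \<Union>?U"
    using sub by blast
  ultimately obtain \<V> where "finite \<V>" "\<V> \<subseteq> ?U" "X - A \<subseteq> \<Union>\<V>"
    by (meson compactinD)
  then obtain \<F> where F: "finite \<F>" "\<F> \<subseteq> P" "X - A \<subseteq> (\<Union>B\<in>\<F>. X - B)"
    by (metis finite_subset_image)
  then have "X \<inter> \<Inter>\<F> \<subseteq> A" "X \<inter> \<Inter>\<F> \<in> P"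
    using filter_finite_Inter[OF P] by blast+
  then show ?thesis
    using P A by (auto simp: sl_filter_S_semilat_iff)
qed

text \<open>This is the filter generated by \<open>P\<close> and \<open>A\<close>; it properly
  extends \<open>P\<close> when \<open>A \<notin> P\<close>.\<close>

lemma filter_adjoin:
  assumes "sl_filter (S_semilat X K) P" "A \<in> Sfam X K"
  shows "sl_filter (S_semilat X K) {C \<in> Sfam X K. \<exists>H\<in>P. A \<inter> H \<subseteq> C}" (is "sl_filter _ ?F")
proof -
  have "C \<inter> D \<in> ?F" if C: "C \<in> ?F" and D: "D \<in> ?F" for C D
  proof -
    obtain H1 H2 where H: "H1 \<in> P" "H2 \<in> P" "A \<inter> H1 \<subseteq> C" "A \<inter> H2 \<subseteq> D"
      using C D by blast
    then have "H1 \<inter> H2 \<in> P"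
      using assms(1) by (simp add: sl_filter_S_semilat_iff)
    moreover have "A \<inter> (H1 \<inter> H2) \<subseteq> C \<inter> D"
      using H by blast
    ultimately show ?thesis
      using Sfam_Int C D by blast
  qed
  moreover have "X \<in> ?F"
    using assms X_in_Sfam Sfam_subset_X by (auto simp: sl_filter_S_semilat_iff)
  moreover have "D \<in> ?F" if "C \<in> ?F" "D \<in> Sfam X K" "C \<subseteq> D" for C D
    using that by blast
  ultimately show ?thesis
    unfolding sl_filter_S_semilat_iff by simp
qed

text \<open>The filters generated by \<open>P\<close> with \<open>A\<close> and by \<open>P\<close>
  with \<open>B\<close> are both strictly larger than \<open>P\<close>, so by irreducibility their
  intersection contains some \<open>C \<notin> P\<close>. The meet of the two witnesses from
  \<open>P\<close> serves as \<open>H\<close>.\<close>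

lemma irr_filter_complement_directed:
  assumes P: "P \<in> irr_filters (S_semilat X K)"
    and A: "A \<in> Sfam X K" "A \<notin> P" and B: "B \<in> Sfam X K" "B \<notin> P"
  shows "\<exists>H\<in>P. \<exists>C\<in>Sfam X K - P. A \<inter> H \<subseteq> C \<and> B \<inter> H \<subseteq> C"
proof -
  define G where "G = (\<lambda>A. {C \<in> Sfam X K. \<exists>H\<in>P. A \<inter> H \<subseteq> C})"
  have fil: "sl_filter (S_semilat X K) P"
    using P by (simp add: irr_filters_def)
  then have PS: "P \<subseteq> Sfam X K" and "X \<in> P"
    by (auto simp: sl_filter_S_semilat_iff)
  then have G: "P \<subseteq> G D" "D \<in> Sfam X K \<Longrightarrow> D \<in> G D" for D
    unfolding G_def by blast+
  have "sl_filter (S_semilat X K) (G A)" "sl_filter (S_semilat X K) (G B)"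
    using filter_adjoin[OF fil] A B by (simp_all add: G_def)
  moreover have "P \<noteq> G A" "P \<noteq> G B"
    using G A B by blast+
  ultimately have "P \<noteq> G A \<inter> G B"
    using P unfolding irr_filters_def by blast
  then obtain C where C: "C \<in> G A" "C \<in> G B" "C \<notin> P"
    using G by blast
  then obtain H1 H2 where H: "C \<in> Sfam X K" "H1 \<in> P" "H2 \<in> P" "A \<inter> H1 \<subseteq> C" "B \<inter> H2 \<subseteq> C"
    unfolding G_def by blast
  then have "H1 \<inter> H2 \<in> P"
    using fil by (simp add: sl_filter_S_semilat_iff)
  moreover have "A \<inter> (H1 \<inter> H2) \<subseteq> C" "B \<inter> (H1 \<inter> H2) \<subseteq> C"
    using H by auto
  ultimately show ?thesis
    using C H by blast
qed

lemma irr_filter_eq_H_map: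
  assumes P: "P \<in> irr_filters (S_semilat X K)"
  shows "\<exists>x\<in>X. P = H_map X K x"
proof -
  have fil: "sl_filter (S_semilat X K) P" and "P \<noteq> Sfam X K"
    using P by (auto simp: irr_filters_def S_semilat_def)
  then have PS: "P \<subseteq> Sfam X K"
    by (simp add: sl_filter_S_semilat_iff)
  define Y where "Y = X \<inter> \<Inter>P"
  define J where "J = Sfam X K - P"
  have "\<exists>H\<in>Sfam X K. \<exists>C\<in>J. Y \<subseteq> H \<and> A \<inter> H \<subseteq> C \<and> B \<inter> H \<subseteq> C" if AB: "A \<in> J" "B \<in> J" for A B
  proof -
    obtain H C where "H \<in> P" "C \<in> J" "A \<inter> H \<subseteq> C" "B \<inter> H \<subseteq> C"
      using irr_filter_complement_directed[OF P, of A B] AB unfolding J_def by blast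
    moreover from this have "H \<in> Sfam X K" "Y \<subseteq> H"
      using PS by (auto simp: Y_def)
    ultimately show ?thesis
      by blast
  qed
  \<comment> \<open>\<open>J\<close> is non-empty because \<open>P\<close> is proper.\<close>
  then have "Y_family X K Y J"
    using PS \<open>P \<noteq> Sfam X K\<close> unfolding Y_family_def J_def by blast
  moreover have "Y \<in> Cfam X K"
    using PS unfolding Cfam_def Y_def by blast
  moreover have "Y \<inter> (X - A) \<noteq> {}" if "A \<in> J" for A
    using filter_Inter_subset_imp_mem[OF fil, of A] that unfolding J_def Y_def by blast
  ultimately have "Y \<inter> (\<Inter>A\<in>J. X - A) \<noteq> {}"
    using S4 by blast
  \<comment> \<open>From \<open>x \<in> Y\<close> follows \<open>P \<subseteq> H_map X K x\<close>;
    avoiding every member of \<open>J\<close> gives the converse inclusion.\<close>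
  then obtain x where "x \<in> Y" "\<And>A. A \<in> J \<Longrightarrow> x \<notin> A"
    by blast
  then show ?thesis
    using PS by (auto simp: H_map_def Y_def J_def)
qed

lemma irr_filters_eq: "irr_filters (S_semilat X K) = H_map X K ` X"
  using H_map_irr irr_filter_eq_H_map by blast

section \<open>Transport along \<open>H_map\<close> and a pointwise description of
  \<open>R_rel\<close>\<close>

lemma H_map_in_beta_iff:
  "A \<in> Sfam X K \<Longrightarrow> x \<in> X \<Longrightarrow> H_map X K x \<in> beta (S_semilat X K) A \<longleftrightarrow> x \<in> A"
  using H_map_irr by (simp add: beta_def) (simp add: H_map_def)

lemma Zfam_subset_X: "Z \<in> Zfam K \<Longrightarrow> Z \<subseteq> X"
  using subset_X by (fastforce simp: Zfam_def)

lemma K_subset_Zfam: "K \<subseteq> Zfam K"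
proof
  fix U assume "U \<in> K"
  then show "U \<in> Zfam K"
    \<comment> \<open>A singleton family is dually directed.\<close>
    unfolding Zfam_def by (intro CollectI exI[of _ "{U}"]) auto
qed

lemma H_map_image_Zfam:
  assumes "Z \<in> Zfam K"
  shows "H_map X K ` Z \<in> Zfam (KA (S_semilat X K))"
proof -
  define h where "h = (\<lambda>U. irr_filters (S_semilat X K) - beta (S_semilat X K) (X - U))"
  obtain L where Z: "Z = \<Inter>L" and L: "L \<subseteq> K" "L \<noteq> {}"
    and dir: "\<forall>U\<in>L. \<forall>V\<in>L. \<exists>W\<in>L. W \<subseteq> U \<and> W \<subseteq> V"
    using assms unfolding Zfam_def by blast
  have h: "h U = H_map X K ` U" if "U \<in> K" for U
    using H_map_in_beta_iff[OF compl_in_Sfam[OF that]] subset_X[OF that]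
    unfolding h_def irr_filters_eq by blast
  have "H_map X K ` Z = \<Inter>(h ` L)"
  proof (intro equalityI subsetI)
    fix P assume "P \<in> H_map X K ` Z"
    then show "P \<in> \<Inter>(h ` L)"
      using h L(1) unfolding Z by auto
  next
    fix P assume P: "P \<in> \<Inter>(h ` L)"
    \<comment> \<open>This relies on \<open>L \<noteq> {}\<close>: an empty intersection would be
      the whole type.\<close>
    then have "P \<in> irr_filters (S_semilat X K)"
      using L unfolding h_def by blast
    then obtain x where x: "x \<in> X" "P = H_map X K x"
      using irr_filter_eq_H_map by blast
    have "x \<in> U" if "U \<in> L" for U
    proof -
      have "U \<in> K" "H_map X K x \<notin> beta (S_semilat X K) (X - U)"
        using x that L(1) INT_D[OF P that] by (auto simp: h_def)
      then show ?thesis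
        using H_map_in_beta_iff[OF compl_in_Sfam x(1)] x(1) by blast
    qed
    then show "P \<in> H_map X K ` Z"
      using x Z by blast
  qed
  moreover have "h ` L \<subseteq> KA (S_semilat X K)"
    using L compl_in_Sfam unfolding h_def KA_def by (fastforce simp: S_semilat_def)
  moreover have "\<forall>U\<in>h ` L. \<forall>V\<in>h ` L. \<exists>W\<in>h ` L. W \<subseteq> U \<and> W \<subseteq> V"
  proof -
    have "\<exists>W\<in>L. h W \<subseteq> h U \<and> h W \<subseteq> h V" if UV: "U \<in> L" "V \<in> L" for U V
    proof -
      obtain W where "W \<in> L" "W \<subseteq> U" "W \<subseteq> V"
        using dir UV by blast
      moreover from this have "h W = H_map X K ` W" "h U = H_map X K ` U" "h V = H_map X K ` V"
        using h L(1) UV by blast+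
      ultimately show ?thesis
        by (metis image_mono)
    qed
    then show ?thesis
      by simp
  qed
  ultimately show ?thesis
    using L unfolding Zfam_def by blast
qed

text \<open>Here \<open>T\<close> is arbitrary, so \<open>Box X T U \<in> Sfam X K\<close> has to be
  stated: \<open>H_map X K x\<close> contains only members of \<open>Sfam X K\<close>. For a
  meet-relation it always holds.\<close>

lemma R_rel_iff:
  "(x, Z) \<in> R_rel X K T \<longleftrightarrow>
     x \<in> X \<and> Z \<in> Zfam K \<and>
     (\<forall>U\<in>Sfam X K. Box X T U \<in> Sfam X K \<and> T `` {x} \<subseteq> U \<longrightarrow> Z \<inter> U \<noteq> {})"
proof (cases "x \<in> X \<and> Z \<in> Zfam K")
  case True
  have carrier: "sl_carrier (S_semilat X K) = Sfam X K"
    by (simp add: S_semilat_def)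
  have "beta (S_semilat X K) U \<inter> H_map X K ` Z = {} \<longleftrightarrow> Z \<inter> U = {}" if "U \<in> Sfam X K" for U
    using H_map_in_beta_iff[OF that] Zfam_subset_X[of Z] True by blast
  then have "I_of (S_semilat X K) (H_map X K ` Z) = {U \<in> Sfam X K. Z \<inter> U = {}}"
    by (auto simp only: I_of_def carrier)
  moreover have "Box X T U \<in> H_map X K x \<longleftrightarrow> Box X T U \<in> Sfam X K \<and> T `` {x} \<subseteq> U" for U
    using True by (simp add: H_map_def Box_def)
  moreover have "(x, Z) \<in> R_rel X K T \<longleftrightarrow>
      {U \<in> Sfam X K. Box X T U \<in> H_map X K x} \<inter> I_of (S_semilat X K) (H_map X K ` Z) = {}"
    using True H_map_irr[of x] H_map_image_Zfam[of Z] by (simp add: R_rel_def R_of_def carrier)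
  ultimately show ?thesis
    using True by (simp only: simp_thms) blast
next
  case False
  then show ?thesis
    by (auto simp: R_rel_def)
qed

end

section \<open>The two identities for a meet-relation\<close>

context MoS_space
begin

lemma m_of_R_rel:
  assumes U: "U \<in> Sfam X K"
  shows "m_of X K (R_rel X K T) U = Box X T U"
proof -
  have Box: "Box X T V \<in> Sfam X K" if "V \<in> Sfam X K" for V
    using that meet_rel by (simp add: meet_relation_def)
  have T: "T `` {x} \<subseteq> X" for x
    using meet_rel by (auto simp: meet_relation_def)
  have "R_rel X K T `` {x} \<subseteq> Lset K U \<longleftrightarrow> T `` {x} \<subseteq> U" if x: "x \<in> X" for x
  proof
    assume "T `` {x} \<subseteq> U"
    then show "R_rel X K T `` {x} \<subseteq> Lset K U"
      using U Box by (auto simp: R_rel_iff Lset_def)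
  next
    assume R: "R_rel X K T `` {x} \<subseteq> Lset K U"
    show "T `` {x} \<subseteq> U"
    proof (rule ccontr)
      assume "\<not> T `` {x} \<subseteq> U"
      \<comment> \<open>A point of \<open>T\<close>
        {x}\<open>outside\<close>U\<open>lies in\<close>X -
        U\<open>and in every\<close>V\<open>containing\<close>T \<open>{x}\<close>, so
        \<open>X - U\<close> meets each such \<open>V\<close>.\<close>
      then have "(x, X - U) \<in> R_rel X K T"
        using x T[of x] compl_in_K[OF U] K_subset_Zfam unfolding R_rel_iff by blast
      then show False
        using R by (auto simp: Lset_def)
    qed
  qed
  then show ?thesis
    by (auto simp: m_of_def Box_def)
qed

lemma T_rel_R_rel: "T_rel X K (R_rel X K T) = T"
proof -
  have Box: "Box X T V \<in> Sfam X K" if "V \<in> Sfam X K" for V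
    using that meet_rel by (simp add: meet_relation_def)
  have "(x, y) \<in> T_rel X K (R_rel X K T) \<longleftrightarrow> (x, y) \<in> T" if xy: "x \<in> X" "y \<in> X" for x y
  proof -
    \<comment> \<open>With \<open>m_of\<close> replaced by \<open>Box\<close>, the condition in
      \<open>N_of\<close> says that \<open>x \<in> Box X T U\<close> implies
      \<open>y \<in> U\<close>.\<close>
    have "(x, y) \<in> T_rel X K (R_rel X K T) \<longleftrightarrow> (\<forall>U\<in>Sfam X K. T `` {x} \<subseteq> U \<longrightarrow> y \<in> U)"
      using xy H_map_irr m_of_R_rel Box
      by (auto simp: T_rel_def N_of_def H_map_def Box_def S_semilat_def)
    also have "\<dots> \<longleftrightarrow> y \<in> X \<inter> \<Inter>{U \<in> Sfam X K. T `` {x} \<subseteq> U}"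
      using xy by blast
    also have "X \<inter> \<Inter>{U \<in> Sfam X K. T `` {x} \<subseteq> U} = T `` {x}"
      using meet_rel xy unfolding meet_relation_def by blast
    finally show ?thesis
      by simp
  qed
  moreover have "T \<subseteq> X \<times> X" "T_rel X K (R_rel X K T) \<subseteq> X \<times> X"
    using meet_rel by (auto simp: meet_relation_def T_rel_def)
  ultimately show ?thesis
    by blast
qed

end

theorem lemma4p5:
  fixes X :: "'a set" and K :: "'a set set" and T :: "('a \<times> 'a) set"
  assumes "MoS_space X K T"
  shows "T = T_rel X K (R_rel X K T) \<and>
         (\<forall>U\<in>Sfam X K. m_of X K (R_rel X K T) U = Box X T U)"
  using MoS_space.m_of_R_rel[OF assms] MoS_space.T_rel_R_rel[OF assms] by simp

end
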